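(* Let $n\geq 3$ and let $L_n$ be the line graph of an $n$-dimensional hypercube-like network. Then $L_n$ is $(2n-4)$-edge-fault-tolerant strongly Menger edge connected. Further, if $k>2n-4$, then $L_n$ is not $k$-edge-fault-tolerant strongly Menger edge connected.
   Context: For two disjoint graphs $G_1,G_2$ with the same number of vertices and a bijection $f:V(G_1)\to V(G_2)$, $G_1\oplus_f G_2$ denotes the graph obtained from $G_1\cup G_2$ by adding the edges $(v,f(v))$ for all $v\in V(G_1)$. The $n$-dimensional hypercube-like networks are defined recursively: $K_2$ is the only $1$-dimensional hypercube-like network; for $n\geq 2$, if $Q^1_{n-1}$ and $Q^2_{n-1}$ are (disjoint) $(n-1)$-dimensional hypercube-like networks, then $Q^1_{n-1}\oplus_f Q^2_{n-1}$ is an $n$-dimensional hypercube-like network for every bijection $f:V(Q^1_{n-1})\to V(Q^2_{n-1})$. The line graph $L(G)$ of a graph $G$ has vertex set $E(G)$, two vertices being adjacent iff the corresponding edges share an end-vertex. A connected graph $G$ is strongly Menger edge connected if for any two distinct vertices $u,v$ of $G$ there are $\min\{\deg_G(u),\deg_G(v)\}$ edge-disjoint $(u,v)$-paths in $G$. For a positive integer $m$, a connected graph $G$ is $m$-edge-fault-tolerant strongly Menger edge connected if $G-F$ is strongly Menger edge connected for every edge set $F\subseteq E(G)$ with $|F|\leq m$ (degrees being taken in $G-F$). *)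

theory Defs
  imports Main
begin

record 'a ugraph =
  verts :: "'a set"
  edges :: "'a set set"

definition upath :: "'a ugraph \<Rightarrow> 'a \<Rightarrow> 'a \<Rightarrow> 'a list \<Rightarrow> bool" where
  "upath G u v p \<longleftrightarrow>
     p \<noteq> [] \<and> hd p = u \<and> last p = v \<and> distinct p \<and> set p \<subseteq> verts G \<and>
     (\<forall>i. Suc i < length p \<longrightarrow> {p ! i, p ! Suc i} \<in> edges G)"

definition path_edges :: "'a list \<Rightarrow> 'a set set" where
  "path_edges p = {{p ! i, p ! Suc i} | i. Suc i < length p}"

definition edge_disjoint_paths :: "'a ugraph \<Rightarrow> 'a \<Rightarrow> 'a \<Rightarrow> nat \<Rightarrow> bool" where
  "edge_disjoint_paths G u v k \<longleftrightarrow>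
     (\<exists>P. finite P \<and> card P = k \<and> (\<forall>p\<in>P. upath G u v p) \<and>
          pairwise (\<lambda>p q. path_edges p \<inter> path_edges q = {}) P)"

definition connected_graph :: "'a ugraph \<Rightarrow> bool" where
  "connected_graph G \<longleftrightarrow>
     verts G \<noteq> {} \<and> (\<forall>u\<in>verts G. \<forall>v\<in>verts G. \<exists>p. upath G u v p)"

definition deg :: "'a ugraph \<Rightarrow> 'a \<Rightarrow> nat" where
  "deg G v = card {e \<in> edges G. v \<in> e}"

definition delete_edges :: "'a ugraph \<Rightarrow> 'a set set \<Rightarrow> 'a ugraph" where
  "delete_edges G F = \<lparr>verts = verts G, edges = edges G - F\<rparr>"

definition line_graph :: "'a ugraph \<Rightarrow> 'a set ugraph" where
  "line_graph G =
     \<lparr>verts = edges G,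
      edges = {{e, e'} | e e'. e \<in> edges G \<and> e' \<in> edges G \<and> e \<noteq> e' \<and> e \<inter> e' \<noteq> {}}\<rparr>"

definition join_by :: "'a ugraph \<Rightarrow> ('a \<Rightarrow> 'a) \<Rightarrow> 'a ugraph \<Rightarrow> 'a ugraph" where
  "join_by G\<^sub>1 f G\<^sub>2 =
     \<lparr>verts = verts G\<^sub>1 \<union> verts G\<^sub>2,
      edges = edges G\<^sub>1 \<union> edges G\<^sub>2 \<union> {{v, f v} | v. v \<in> verts G\<^sub>1}\<rparr>"

text \<open>Both halves live on disjoint subsets of one type, and \<open>K\<^sub>2\<close> may sit on any two
  distinct points, so the class is closed under isomorphism. The predicate never holds in
  dimension 0.\<close>

inductive hypercube_like :: "nat \<Rightarrow> 'a ugraph \<Rightarrow> bool" where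
  K2: "a \<noteq> b \<Longrightarrow> hypercube_like 1 \<lparr>verts = {a, b}, edges = {{a, b}}\<rparr>"
| join: "\<lbrakk>hypercube_like n Q\<^sub>1; hypercube_like n Q\<^sub>2; verts Q\<^sub>1 \<inter> verts Q\<^sub>2 = {};
          bij_betw f (verts Q\<^sub>1) (verts Q\<^sub>2)\<rbrakk>
         \<Longrightarrow> hypercube_like (Suc n) (join_by Q\<^sub>1 f Q\<^sub>2)"

definition strongly_Menger_edge_connected :: "'a ugraph \<Rightarrow> bool" where
  "strongly_Menger_edge_connected G \<longleftrightarrow>
     connected_graph G \<and>
     (\<forall>u\<in>verts G. \<forall>v\<in>verts G. u \<noteq> v \<longrightarrow>
        edge_disjoint_paths G u v (min (deg G u) (deg G v)))"

text \<open>The notion is customarily used for positive \<open>m\<close> only; the finiteness of \<open>F\<close> is explicit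
  because an infinite set has \<open>card\<close> 0.\<close>

definition edge_fault_tolerant_strongly_Menger :: "nat \<Rightarrow> 'a ugraph \<Rightarrow> bool" where
  "edge_fault_tolerant_strongly_Menger m G \<longleftrightarrow>
     connected_graph G \<and>
     (\<forall>F. F \<subseteq> edges G \<and> finite F \<and> card F \<le> m \<longrightarrow>
        strongly_Menger_edge_connected (delete_edges G F))"

end

theory Submission
  imports Defs
begin

text \<open>
  By Menger's theorem for edges it suffices to bound cuts. A set \<open>X\<close> of edges of \<open>Q\<close> meeting a
  vertex \<open>w\<close> in \<open>x\<^sub>w\<close> edges has \<open>\<Sum>w. x\<^sub>w (n - x\<^sub>w)\<close> cut edges in the line graph. Only vertices
  with \<open>0 < x\<^sub>w < n\<close> contribute, and since \<open>Q\<close> is \<open>n\<close>-connected, few such vertices force \<open>X\<close> or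
  its complement to live on them. Hence every cut with at least two vertices on both sides has at
  least \<open>4n - 6 = (2n - 4) + (2n - 2)\<close> edges, so that after \<open>2n - 4\<close> faults only the cuts around
  single vertices can be smaller than \<open>2n - 2\<close>. Conversely, deleting all but one of the \<open>2n - 2\<close>
  edges at a vertex \<open>w\<close> of the line graph leaves its remaining neighbour with full degree but
  with one edge that leads to a dead end.
\<close>

section \<open>Finite simple graphs and their edge cuts\<close>

definition wf_graph :: "'a ugraph \<Rightarrow> bool" where
  "wf_graph G \<longleftrightarrow> finite (verts G) \<and> (\<forall>e\<in>edges G. e \<subseteq> verts G \<and> card e = 2)"

text \<open>In a well-formed graph these are the edges with exactly one end in
  \<open>X\<close>.\<close>

definition edge_cut :: "'a ugraph \<Rightarrow> 'a set \<Rightarrow> 'a set set" where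
  "edge_cut G X = {e \<in> edges G. e \<inter> X \<noteq> {} \<and> \<not> e \<subseteq> X}"

lemma wf_graph_finite_edges: "wf_graph G \<Longrightarrow> finite (edges G)"
  unfolding wf_graph_def by (metis PowI finite_Pow_iff finite_subset subsetI)

lemma wf_graph_edgeD: "wf_graph G \<Longrightarrow> {x, y} \<in> edges G \<Longrightarrow> x \<in> verts G \<and> y \<in> verts G \<and> x \<noteq> y"
  unfolding wf_graph_def by fastforce

lemma edge_cut_singleton:
  assumes "wf_graph G"
  shows "card (edge_cut G {v}) = deg G v"
proof -
  have "\<not> e \<subseteq> {v}" if "e \<in> edges G" for e
    using assms that card_mono[of "{v}" e] by (fastforce simp: wf_graph_def)
  then have "edge_cut G {v} = {e \<in> edges G. v \<in> e}"
    by (auto simp: edge_cut_def)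
  then show ?thesis
    by (simp add: deg_def)
qed

lemma edge_cut_complement:
  assumes "wf_graph G" "X \<subseteq> verts G"
  shows "edge_cut G (verts G - X) = edge_cut G X"
  using assms unfolding wf_graph_def edge_cut_def by blast

subsection \<open>Menger's theorem for edges\<close>

text \<open>The divergence of the 0-1 flow carried by the arcs in \<open>D\<close>: outgoing minus
  incoming arcs at \<open>x\<close>.\<close>

definition net :: "('a \<times> 'a) set \<Rightarrow> 'a \<Rightarrow> int" where
  "net D x = (\<Sum>a\<in>D. of_bool (fst a = x) - of_bool (snd a = x))"

text \<open>The directed counterpart of \<open>path_edges\<close>; directions are needed so that
  opposite arcs can cancel.\<close>

definition arcs :: "'a list \<Rightarrow> ('a \<times> 'a) set" where
  "arcs p = set (zip p (tl p))"

lemma net_Un: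
  "finite A \<Longrightarrow> finite B \<Longrightarrow> A \<inter> B = {} \<Longrightarrow> net (A \<union> B) x = net A x + net B x"
  by (simp add: net_def sum.union_disjoint)

lemma net_converse: "net (D\<inverse>) x = - net D x"
proof -
  have "D\<inverse> = prod.swap ` D" by auto
  then have "net (D\<inverse>) x = (\<Sum>a\<in>D. of_bool (snd a = x) - of_bool (fst a = x))"
    unfolding net_def by (simp add: sum.reindex o_def)
  then show ?thesis
    by (simp add: net_def sum_negf[symmetric])
qed

text \<open>After exchanging the two sums, arcs with both ends in \<open>X\<close> cancel and only
  boundary arcs count.\<close>

lemma sum_net:
  assumes "finite X"
  shows "(\<Sum>x\<in>X. net D x) = (\<Sum>a\<in>D. of_bool (fst a \<in> X) - of_bool (snd a \<in> X))"
  unfolding net_def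
  by (subst sum.swap) (use assms in \<open>simp add: sum_subtractf of_bool_def\<close>)

lemma arcs_simps [simp]:
  "arcs [] = {}" "arcs [x] = {}" "arcs (x # y # p) = insert (x, y) (arcs (y # p))"
  by (simp_all add: arcs_def)

lemma arcs_subset: "arcs p \<subseteq> set p \<times> set p"
  by (induction p rule: induct_list012) auto

lemma finite_arcs [simp]: "finite (arcs p)"
  by (simp add: arcs_def)

text \<open>A simple path is a flow of value one; the contributions at inner vertices telescope
  away.\<close>

lemma net_arcs:
  "p \<noteq> [] \<Longrightarrow> distinct p \<Longrightarrow> net (arcs p) x = of_bool (hd p = x) - of_bool (last p = x)"
proof (induction p rule: induct_list012)
  case (3 a b p)
  have "(a, b) \<notin> arcs (b # p)"
    using 3 arcs_subset[of "b # p"] by auto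
  then have "net (arcs (a # b # p)) x = of_bool (a = x) - of_bool (b = x) + net (arcs (b # p)) x"
    by (simp add: net_def)
  with 3 show ?case by simp
qed (auto simp: net_def)

lemma arcs_antisym: "distinct p \<Longrightarrow> arcs p \<inter> (arcs p)\<inverse> = {}"
proof (induction p rule: induct_list012)
  case (3 a b p)
  then show ?case
    using arcs_subset[of "b # p"] by auto
qed auto

lemma arcs_nth: "arcs p = {(p ! i, p ! Suc i) | i. Suc i < length p}"
  by (cases p) (auto simp: arcs_def set_zip)

lemma path_edges_arcs: "path_edges p = (\<lambda>(x, y). {x, y}) ` arcs p"
  unfolding path_edges_def arcs_nth by force

lemma arcs_nonempty: "p \<noteq> [] \<Longrightarrow> hd p \<noteq> last p \<Longrightarrow> arcs p \<noteq> {}"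
  by (induction p rule: induct_list012) auto

text \<open>The path is built from its end backwards; if the new start already occurs, the suffix
  from that occurrence is used instead.\<close>

lemma rtrancl_distinct_path:
  assumes "(s, t) \<in> R\<^sup>*"
  shows "\<exists>p. p \<noteq> [] \<and> hd p = s \<and> last p = t \<and> distinct p \<and> arcs p \<subseteq> R"
  using assms
proof (induction rule: converse_rtrancl_induct)
  case base
  show ?case by (rule exI[of _ "[t]"]) auto
next
  case (step y z)
  then obtain p where p: "p \<noteq> []" "hd p = z" "last p = t" "distinct p" "arcs p \<subseteq> R"
    by blast
  show ?case
  proof (cases "y \<in> set p")
    case True
    then obtain q r where pq: "p = q @ y # r"
      by (auto simp: in_set_conv_decomp)
    have "arcs (y # r) \<subseteq> arcs (q @ y # r)" for q
    proof (induction q rule: induct_list012)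
      case (2 x)
      then show ?case by auto
    qed auto
    with p pq show ?thesis
      by (intro exI[of _ "y # r"]) auto
  next
    case False
    with p step show ?thesis
      by (intro exI[of _ "y # p"]) (cases p, auto)
  qed
qed

lemma upath_arcs:
  assumes "wf_graph G" "u \<in> verts G" "p \<noteq> []" "hd p = u" "last p = v" "distinct p"
    and edges: "\<And>x y. (x, y) \<in> arcs p \<Longrightarrow> {x, y} \<in> edges G"
  shows "upath G u v p"
proof -
  have "set p \<subseteq> verts G"
  proof
    fix x assume "x \<in> set p"
    then obtain i where i: "i < length p" "x = p ! i"
      by (auto simp: in_set_conv_nth)
    show "x \<in> verts G"
    proof (cases i)
      case 0
      then show ?thesis using i assms by (simp add: hd_conv_nth)
    next
      case (Suc j)
      then have "(p ! j, x) \<in> arcs p"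
        using i by (auto simp: arcs_nth)
      then have "{p ! j, x} \<in> edges G"
        by (rule edges)
      then show ?thesis
        using wf_graph_edgeD[OF assms(1)] by simp
    qed
  qed
  moreover have "{p ! i, p ! Suc i} \<in> edges G" if "Suc i < length p" for i
    using that by (intro edges) (auto simp: arcs_nth)
  ultimately show ?thesis
    using assms by (simp add: upath_def)
qed

text \<open>An integral flow in which every edge has capacity one and carries flow in at most one
  direction, given by its set of used arcs.\<close>

definition unit_flow :: "'a ugraph \<Rightarrow> 'a \<Rightarrow> 'a \<Rightarrow> nat \<Rightarrow> ('a \<times> 'a) set \<Rightarrow> bool" where
  "unit_flow G s t j D \<longleftrightarrow>
     (\<forall>(x, y)\<in>D. {x, y} \<in> edges G) \<and> D \<inter> D\<inverse> = {} \<and>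
     (\<forall>x. net D x = int j * (of_bool (s = x) - of_bool (t = x)))"

lemma unit_flow_finite:
  assumes "wf_graph G" "unit_flow G s t j D"
  shows "finite D"
proof (rule finite_subset)
  show "D \<subseteq> verts G \<times> verts G"
    using assms wf_graph_edgeD[OF assms(1)] by (fastforce simp: unit_flow_def)
  show "finite (verts G \<times> verts G)"
    using assms by (simp add: wf_graph_def)
qed

text \<open>By conservation only \<open>s\<close> contributes to the total divergence over
  \<open>X\<close>, so the net flow across every cut is the flow value.\<close>

lemma unit_flow_across:
  assumes "unit_flow G s t j D" "finite X" "s \<in> X" "t \<notin> X"
  shows "(\<Sum>a\<in>D. of_bool (fst a \<in> X) - of_bool (snd a \<in> X)) = int j"
proof -
  have "(\<Sum>x\<in>X. net D x) = (\<Sum>x\<in>X. int j * of_bool (s = x))"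
    using assms by (intro sum.cong) (auto simp: unit_flow_def)
  also have "\<dots> = int j"
    using assms by (simp add: of_bool_def sum.delta flip: sum_distrib_left)
  finally show ?thesis
    using sum_net[OF assms(2)] by metis
qed

lemma reachable_verts:
  assumes "wf_graph G" "s \<in> verts G" "\<And>x y. (x, y) \<in> R \<Longrightarrow> {x, y} \<in> edges G"
  shows "R\<^sup>* `` {s} \<subseteq> verts G"
proof
  fix x assume "x \<in> R\<^sup>* `` {s}"
  then have "(s, x) \<in> R\<^sup>*" by simp
  then show "x \<in> verts G"
  proof induction
    case base
    show ?case by (rule assms(2))
  next
    case (step y z)
    then show ?case
      using wf_graph_edgeD[OF assms(1) assms(3)] by simp
  qed
qed

text \<open>The Ford-Fulkerson step. If \<open>t\<close> is unreachable in the residual relation,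
  the reachable set is a cut of size \<open>j < k\<close>; otherwise the flow is changed along a
  residual path.\<close>

lemma unit_flow_augment:
  assumes wf: "wf_graph G" and s: "s \<in> verts G"
    and cut: "\<And>X. X \<subseteq> verts G \<Longrightarrow> s \<in> X \<Longrightarrow> t \<notin> X \<Longrightarrow> k \<le> card (edge_cut G X)"
    and flow: "unit_flow G s t j D" and "j < k"
  shows "\<exists>D'. unit_flow G s t (Suc j) D'"
proof -
  define R where "R = {(x, y). {x, y} \<in> edges G \<and> (x, y) \<notin> D}"
  note finD = unit_flow_finite[OF wf flow]
  have DE: "\<And>x y. (x, y) \<in> D \<Longrightarrow> {x, y} \<in> edges G" and anti: "D \<inter> D\<inverse> = {}"
    using flow by (auto simp: unit_flow_def)
  have "(s, t) \<in> R\<^sup>*"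
  proof (rule ccontr)
    assume nr: "(s, t) \<notin> R\<^sup>*"
    define X where "X = R\<^sup>* `` {s}"
    have X: "X \<subseteq> verts G" "s \<in> X" "t \<notin> X"
      using reachable_verts[OF wf s, of R] nr by (auto simp: X_def R_def)
    then have finX: "finite X"
      using wf finite_subset by (auto simp: wf_graph_def)
    define C where "C = {a \<in> D. fst a \<in> X \<and> snd a \<notin> X}"
    have sat: "(x, y) \<in> D" if "{x, y} \<in> edges G" "x \<in> X" "y \<notin> X" for x y
    proof (rule ccontr)
      assume "(x, y) \<notin> D"
      with that have "(x, y) \<in> R" by (simp add: R_def)
      with that(2) have "y \<in> X" unfolding X_def by (auto intro: rtrancl_into_rtrancl)
      with that show False by simp
    qed
    \<comment> \<open>Reversed, such an arc would be an edge leaving \<open>X\<close>, hence in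
      \<open>D\<close> by \<open>sat\<close>, against antisymmetry.\<close>
    have no_back: "\<not> (fst a \<notin> X \<and> snd a \<in> X)" if "a \<in> D" for a
    proof
      assume a: "fst a \<notin> X \<and> snd a \<in> X"
      have "(snd a, fst a) \<in> D"
        using a that DE[of "fst a" "snd a"] by (intro sat) (auto simp: insert_commute)
      with that anti show False
        by (metis IntI converse_iff empty_iff prod.collapse)
    qed
    have "int j = (\<Sum>a\<in>D. of_bool (fst a \<in> X) - of_bool (snd a \<in> X))"
      using unit_flow_across[OF flow finX] X by simp
    also have "\<dots> = (\<Sum>a\<in>D. of_bool (a \<in> C))"
      using no_back by (intro sum.cong) (auto simp: C_def)
    also have "\<dots> = int (card C)"
      using finD by (auto simp: C_def Int_def of_bool_def sum.If_cases)
    finally have "j = card C" by simp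
    moreover have "edge_cut G X \<subseteq> (\<lambda>(x, y). {x, y}) ` C"
    proof
      fix e assume e: "e \<in> edge_cut G X"
      then obtain x y where xy: "x \<in> e" "x \<in> X" "y \<in> e" "y \<notin> X"
        by (auto simp: edge_cut_def)
      moreover have "card e = 2" "e \<in> edges G"
        using e wf by (auto simp: edge_cut_def wf_graph_def)
      ultimately have "e = {x, y}"
        by (auto simp: card_2_iff)
      then have "(x, y) \<in> C"
        using sat xy \<open>e \<in> edges G\<close> by (auto simp: C_def)
      with \<open>e = {x, y}\<close> show "e \<in> (\<lambda>(x, y). {x, y}) ` C"
        by auto
    qed
    then have "card (edge_cut G X) \<le> card C"
      using finD by (intro surj_card_le) (auto simp: C_def)
    ultimately show False
      using cut[OF X] \<open>j < k\<close> by simp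
  qed
  then obtain p where p: "p \<noteq> []" "hd p = s" "last p = t" "distinct p" "arcs p \<subseteq> R"
    using rtrancl_distinct_path by metis
  define A where "A = arcs p"
  \<comment> \<open>Arcs of the path that run against used arcs cancel with them; all other arcs of
    both sets are kept.\<close>
  define D' where "D' = (D - A\<inverse>) \<union> (A - D\<inverse>)"
  have A: "finite A" "A \<inter> A\<inverse> = {}" "A \<inter> D = {}" "\<And>x y. (x, y) \<in> A \<Longrightarrow> {x, y} \<in> edges G"
    using p arcs_antisym[of p] by (auto simp: A_def R_def)
  have "net D' x = net D x + net A x" for x
  proof -
    have "net D x = net (D - A\<inverse>) x + net (D \<inter> A\<inverse>) x"
      using finD by (subst net_Un[symmetric]) (auto simp: Int_Diff Un_Diff_Int)
    moreover have "net A x = net (A - D\<inverse>) x + net (A \<inter> D\<inverse>) x"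
      using A(1) by (subst net_Un[symmetric]) (auto simp: Int_Diff Un_Diff_Int)
    moreover have "A \<inter> D\<inverse> = (D \<inter> A\<inverse>)\<inverse>" by auto
    moreover have "net D' x = net (D - A\<inverse>) x + net (A - D\<inverse>) x"
      unfolding D'_def using finD A by (intro net_Un) auto
    ultimately show ?thesis
      using net_converse[of "D \<inter> A\<inverse>" x] by simp
  qed
  moreover have "net A x = of_bool (s = x) - of_bool (t = x)" for x
    using net_arcs[of p] p by (simp add: A_def)
  moreover have "net D x = int j * (of_bool (s = x) - of_bool (t = x))" for x
    using flow by (simp add: unit_flow_def)
  moreover have "D' \<inter> D'\<inverse> = {}"
    using A(2,3) anti unfolding D'_def by blast
  ultimately have "unit_flow G s t (Suc j) D'"
    using DE A(4) by (auto simp: unit_flow_def D'_def algebra_simps)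
  then show ?thesis by blast
qed

text \<open>Paths are peeled off one at a time. While the value is positive, \<open>t\<close> is
  reachable along \<open>D\<close>, since otherwise no arc leaves the reachable set. The inclusion
  \<open>arcs p \<subseteq> D\<close> is carried through the induction to keep later paths disjoint
  from earlier ones.\<close>

lemma unit_flow_decompose:
  assumes wf: "wf_graph G" and st: "s \<in> verts G" "s \<noteq> t" and "unit_flow G s t j D"
  shows "\<exists>P. finite P \<and> card P = j \<and> (\<forall>p\<in>P. upath G s t p \<and> arcs p \<subseteq> D) \<and>
    pairwise (\<lambda>p q. path_edges p \<inter> path_edges q = {}) P"
  using assms(4)
proof (induction j arbitrary: D)
  case 0
  show ?case by (rule exI[of _ "{}"]) (simp add: pairwise_def)
next
  case (Suc j)
  note finD = unit_flow_finite[OF wf Suc.prems]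
  have DE: "\<And>x y. (x, y) \<in> D \<Longrightarrow> {x, y} \<in> edges G" and anti: "D \<inter> D\<inverse> = {}"
    using Suc.prems by (auto simp: unit_flow_def)
  have "(s, t) \<in> D\<^sup>*"
  proof (rule ccontr)
    assume nr: "(s, t) \<notin> D\<^sup>*"
    define X where "X = D\<^sup>* `` {s}"
    have X: "X \<subseteq> verts G" "s \<in> X" "t \<notin> X"
      using reachable_verts[OF wf st(1), of D] nr DE by (auto simp: X_def)
    then have finX: "finite X"
      using wf finite_subset by (auto simp: wf_graph_def)
    have "snd a \<in> X" if "fst a \<in> X" "a \<in> D" for a
      using that unfolding X_def
      by (metis Image_singleton_iff prod.collapse rtrancl.rtrancl_into_rtrancl)
    then have "(\<Sum>a\<in>D. of_bool (fst a \<in> X) - of_bool (snd a \<in> X)) \<le> (0::int)"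
      by (intro sum_nonpos) auto
    with unit_flow_across[OF Suc.prems finX X(2,3)] show False
      by simp
  qed
  then obtain p where p: "p \<noteq> []" "hd p = s" "last p = t" "distinct p" "arcs p \<subseteq> D"
    using rtrancl_distinct_path by metis
  have "net D x = net (D - arcs p) x + net (arcs p) x" for x
    using finD p(5) by (subst net_Un[symmetric]) (auto simp: Un_absorb2)
  then have "net (D - arcs p) x = net D x - net (arcs p) x" for x
    by simp
  moreover have "net (arcs p) x = of_bool (s = x) - of_bool (t = x)" for x
    using p net_arcs[of p x] by simp
  moreover have "net D x = int (Suc j) * (of_bool (s = x) - of_bool (t = x))" for x
    using Suc.prems by (simp add: unit_flow_def)
  ultimately have "net (D - arcs p) x = int j * (of_bool (s = x) - of_bool (t = x))" for x
    by (simp add: algebra_simps)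
  then have "unit_flow G s t j (D - arcs p)"
    using DE anti by (auto simp: unit_flow_def)
  from Suc.IH[OF this] obtain P where P: "finite P" "card P = j"
    "\<forall>q\<in>P. upath G s t q \<and> arcs q \<subseteq> D - arcs p"
    "pairwise (\<lambda>p q. path_edges p \<inter> path_edges q = {}) P"
    by (elim exE conjE)
  \<comment> \<open>As \<open>s \<noteq> t\<close>, \<open>p\<close> has an arc, while the paths in
    \<open>P\<close> avoid all arcs of \<open>p\<close>.\<close>
  have "p \<notin> P"
    using P(3) arcs_nonempty[of p] p st by auto
  moreover have "upath G s t p"
    using p DE st by (intro upath_arcs wf) auto
  \<comment> \<open>Disjoint arc sets could still share an edge in opposite directions; antisymmetry
    of \<open>D\<close> excludes this.\<close>
  moreover have disj: "path_edges p \<inter> path_edges q = {}" if "q \<in> P" for q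
  proof -
    have "False" if "(x, y) \<in> arcs p" "(x', y') \<in> arcs q" "{x, y} = {x', y'}" for x y x' y'
      using that p(5) P(3) \<open>q \<in> P\<close> anti by (auto simp: doubleton_eq_iff)
    then show ?thesis
      unfolding path_edges_arcs by fast
  qed
  ultimately have "card (insert p P) = Suc j" "\<forall>q\<in>insert p P. upath G s t q \<and> arcs q \<subseteq> D"
    "pairwise (\<lambda>p q. path_edges p \<inter> path_edges q = {}) (insert p P)"
    using P p(5) by (simp, blast, simp add: pairwise_insert Int_commute)
  then show ?case
    using P(1) by (intro exI[of _ "insert p P"]) simp
qed

text \<open>The empty flow is augmented \<open>k\<close> times and the result decomposed into
  paths.\<close>

theorem edge_Menger:
  assumes "wf_graph G" "s \<in> verts G" "s \<noteq> t"
    and "\<And>X. X \<subseteq> verts G \<Longrightarrow> s \<in> X \<Longrightarrow> t \<notin> X \<Longrightarrow> k \<le> card (edge_cut G X)"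
  shows "edge_disjoint_paths G s t k"
proof -
  have "\<exists>D. unit_flow G s t j D" if "j \<le> k" for j
    using that
  proof (induction j)
    case 0
    show ?case by (rule exI[of _ "{}"]) (simp add: unit_flow_def net_def)
  next
    case (Suc j)
    then obtain D where "unit_flow G s t j D" by auto
    then show ?case
      using unit_flow_augment[OF assms(1,2,4)] Suc.prems by (simp add: Suc_le_eq)
  qed
  then obtain D where "unit_flow G s t k D" by blast
  from unit_flow_decompose[OF assms(1-3) this] show ?thesis
    unfolding edge_disjoint_paths_def by blast
qed

subsection \<open>Hypercube-like networks\<close>

lemma hypercube_like_wf: "hypercube_like n Q \<Longrightarrow> wf_graph Q"
proof (induction rule: hypercube_like.induct)
  case (K2 a b)
  then show ?case by (simp add: wf_graph_def)
next
  case (join n Q1 Q2 f)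
  have "card {v, f v} = 2 \<and> f v \<in> verts Q2" if "v \<in> verts Q1" for v
  proof -
    have "f v \<in> verts Q2" "v \<noteq> f v"
      using that join.hyps(3) bij_betwE[OF join.hyps(4)] by (metis IntI empty_iff)+
    then show ?thesis by simp
  qed
  then show ?case
    using join.IH unfolding wf_graph_def join_by_def by auto
qed

lemma hypercube_like_card_verts: "hypercube_like n Q \<Longrightarrow> card (verts Q) = 2 ^ n"
proof (induction rule: hypercube_like.induct)
  case (K2 a b)
  then show ?case by simp
next
  case (join n Q1 Q2 f)
  then show ?case
    using hypercube_like_wf[OF join.hyps(1)] hypercube_like_wf[OF join.hyps(2)]
    by (simp add: join_by_def card_Un_disjoint wf_graph_def)
qed

text \<open>Each join gives every vertex exactly one new edge, its matching edge.\<close>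

lemma hypercube_like_deg: "hypercube_like n Q \<Longrightarrow> v \<in> verts Q \<Longrightarrow> deg Q v = n"
proof (induction arbitrary: v rule: hypercube_like.induct)
  case (K2 a b)
  then have "{e \<in> {{a, b}}. v \<in> e} = {{a, b}}" by auto
  then show ?case by (simp add: deg_def)
next
  case (join n Q1 Q2 f)
  have wf: "wf_graph Q1" "wf_graph Q2"
    using join.hyps hypercube_like_wf by blast+
  have E: "e \<subseteq> verts Q1" if "e \<in> edges Q1" for e using that wf by (simp add: wf_graph_def)
  have E': "e \<subseteq> verts Q2" if "e \<in> edges Q2" for e using that wf by (simp add: wf_graph_def)
  have f: "\<And>u. u \<in> verts Q1 \<Longrightarrow> f u \<in> verts Q2" and inj: "inj_on f (verts Q1)"
    using join.hyps(4) by (auto simp: bij_betw_def)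
  have fin: "finite (edges Q1)" "finite (edges Q2)"
    using wf wf_graph_finite_edges by blast+
  have "v \<in> verts Q1 \<or> v \<in> verts Q2"
    using join.prems by (simp add: join_by_def)
  then show ?case
  proof
    assume v: "v \<in> verts Q1"
    have "v \<notin> e" if "e \<in> edges Q2" for e
      using v E'[OF that] join.hyps(3) by blast
    then have "{e \<in> edges (join_by Q1 f Q2). v \<in> e} = insert {v, f v} {e \<in> edges Q1. v \<in> e}"
      using v f join.hyps(3) by (auto simp: join_by_def)
    moreover have "{v, f v} \<notin> edges Q1"
      using v f join.hyps(3) E by blast
    ultimately show ?thesis
      using join.IH(1)[OF v] fin by (simp add: deg_def)
  next
    assume v: "v \<in> verts Q2"
    then obtain u where u: "u \<in> verts Q1" "v = f u"
      using join.hyps(4) by (auto simp: bij_betw_def)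
    have "v \<notin> e" if "e \<in> edges Q1" for e
      using v E[OF that] join.hyps(3) by blast
    then have "{e \<in> edges (join_by Q1 f Q2). v \<in> e} = insert {u, v} {e \<in> edges Q2. v \<in> e}"
      using u v f join.hyps(3) inj by (auto simp: join_by_def dest: inj_onD)
    moreover have "{u, v} \<notin> edges Q2"
      using u join.hyps(3) E' by blast
    ultimately show ?thesis
      using join.IH(2)[OF v] fin by (simp add: deg_def)
  qed
qed

text \<open>This is \<open>n\<close>-connectivity, with the separator written as what remains
  outside \<open>A\<close> and \<open>B\<close>. The induction distinguishes which halves meet both
  sets.\<close>

lemma hypercube_like_separator:
  assumes "hypercube_like n Q" "A \<subseteq> verts Q" "B \<subseteq> verts Q" "A \<inter> B = {}" "A \<noteq> {}" "B \<noteq> {}"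
    and "\<And>a b. a \<in> A \<Longrightarrow> b \<in> B \<Longrightarrow> {a, b} \<notin> edges Q"
  shows "n \<le> card (verts Q - A - B)"
  using assms
proof (induction arbitrary: A B rule: hypercube_like.induct)
  case (K2 a b)
  then have "a \<in> A \<and> b \<in> B \<or> b \<in> A \<and> a \<in> B" by auto
  then show ?case
    using K2.prems(6)[of a b] K2.prems(6)[of b a] by (auto simp: insert_commute)
next
  case (join n Q1 Q2 f)
  let ?Q = "join_by Q1 f Q2"
  have wf: "wf_graph Q1" "wf_graph Q2"
    using join.hyps hypercube_like_wf by blast+
  then have fin: "finite (verts Q1)" "finite (verts Q2)"
    by (auto simp: wf_graph_def)
  have f: "\<And>u. u \<in> verts Q1 \<Longrightarrow> f u \<in> verts Q2" and inj: "inj_on f (verts Q1)"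
    and surj: "\<And>v. v \<in> verts Q2 \<Longrightarrow> \<exists>u\<in>verts Q1. v = f u"
    using join.hyps(4) by (auto simp: bij_betw_def)
  define M1 where "M1 = verts Q1 - A - B"
  define M2 where "M2 = verts Q2 - A - B"
  have card: "card (verts ?Q - A - B) = card M1 + card M2"
  proof -
    have "verts ?Q - A - B = M1 \<union> M2"
      by (auto simp: join_by_def M1_def M2_def)
    then show ?thesis
      using fin join.hyps(3) by (auto simp: M1_def M2_def intro!: card_Un_disjoint)
  qed
  have M: "finite M1" "finite M2" using fin by (auto simp: M1_def M2_def)
  have match: "\<not> (v \<in> A \<and> f v \<in> B)" "\<not> (v \<in> B \<and> f v \<in> A)" if "v \<in> verts Q1" for v
  proof -
    have "{v, f v} \<in> edges ?Q" using that by (auto simp: join_by_def)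
    then show "\<not> (v \<in> A \<and> f v \<in> B)" "\<not> (v \<in> B \<and> f v \<in> A)"
      using join.prems(6)[of v "f v"] join.prems(6)[of "f v" v] by (auto simp: insert_commute)
  qed
  have one: "n \<le> card M1" if "A \<inter> verts Q1 \<noteq> {}" "B \<inter> verts Q1 \<noteq> {}"
  proof -
    have "n \<le> card (verts Q1 - A \<inter> verts Q1 - B \<inter> verts Q1)"
      using that join.prems(3,6) by (intro join.IH(1)) (auto simp: join_by_def)
    moreover have "verts Q1 - A \<inter> verts Q1 - B \<inter> verts Q1 = M1"
      by (auto simp: M1_def)
    ultimately show ?thesis by simp
  qed
  have two: "n \<le> card M2" if "A \<inter> verts Q2 \<noteq> {}" "B \<inter> verts Q2 \<noteq> {}"
  proof -
    have "n \<le> card (verts Q2 - A \<inter> verts Q2 - B \<inter> verts Q2)"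
      using that join.prems(3,6) by (intro join.IH(2)) (auto simp: join_by_def)
    moreover have "verts Q2 - A \<inter> verts Q2 - B \<inter> verts Q2 = M2"
      by (auto simp: M2_def)
    ultimately show ?thesis by simp
  qed
  have npos: "1 \<le> n"
    using join.hyps(1) by (induction rule: hypercube_like.induct) auto
  consider "A \<inter> verts Q1 \<noteq> {}" "B \<inter> verts Q1 \<noteq> {}" "A \<inter> verts Q2 \<noteq> {}" "B \<inter> verts Q2 \<noteq> {}"
    | "A \<inter> verts Q1 \<noteq> {}" "B \<inter> verts Q1 \<noteq> {}" "A \<inter> verts Q2 = {} \<or> B \<inter> verts Q2 = {}"
    | "A \<inter> verts Q2 \<noteq> {}" "B \<inter> verts Q2 \<noteq> {}" "A \<inter> verts Q1 = {} \<or> B \<inter> verts Q1 = {}"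
    | "A \<inter> verts Q1 = {} \<or> B \<inter> verts Q1 = {}" "A \<inter> verts Q2 = {} \<or> B \<inter> verts Q2 = {}"
    by blast
  then have "Suc n \<le> card M1 + card M2"
  proof cases
    case 1
    \<comment> \<open>Both halves are separated, so there are at least
      \<open>2 * n \<ge> n + 1\<close> remaining vertices.\<close>
    then show ?thesis using one two npos by linarith
  next
    case 2
    \<comment> \<open>Only the first half is separated. Of \<open>A\<close> and \<open>B\<close>,
      one misses the second half; the partner of a vertex of that set lies in neither, which
      supplies the extra vertex.\<close>
    then obtain a b where "a \<in> A" "b \<in> B" "a \<in> verts Q1" "b \<in> verts Q1" by blast
    with 2(3) f match have "f a \<in> M2 \<or> f b \<in> M2"
      unfolding M2_def by blast
    then have "card M2 \<noteq> 0" using M by auto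
    then show ?thesis using one 2 by linarith
  next
    case 3
    then obtain a b where ab: "f a \<in> A" "f b \<in> B" "a \<in> verts Q1" "b \<in> verts Q1"
      using surj by blast
    with 3(3) match have "a \<in> M1 \<or> b \<in> M1"
      unfolding M1_def by blast
    then have "card M1 \<noteq> 0" using M by auto
    then show ?thesis using two 3 by linarith
  next
    case 4
    \<comment> \<open>Here \<open>A\<close> and \<open>B\<close> lie in different halves, so every
      matching edge has an end in the separator. Choosing one such end injects
      \<open>verts Q1\<close> into it, and \<open>2 ^ n > n\<close>.\<close>
    define g where "g v = (if v \<in> M1 then v else f v)" for v
    have AB: "A \<noteq> {}" "B \<noteq> {}" "A \<union> B \<subseteq> verts Q1 \<union> verts Q2"
      using join.prems by (auto simp: join_by_def)
    have "v \<in> M1 \<or> f v \<in> M2" if "v \<in> verts Q1" for v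
      using that 4 AB f[OF that] match[OF that] unfolding M1_def M2_def by blast
    then have "g ` verts Q1 \<subseteq> M1 \<union> M2"
      by (auto simp: g_def)
    moreover have "inj_on g (verts Q1)"
      using inj f join.hyps(3) by (auto simp: inj_on_def g_def M1_def)
    ultimately have "card (verts Q1) \<le> card (M1 \<union> M2)"
      using M by (intro card_inj_on_le) auto
    also have "\<dots> \<le> card M1 + card M2"
      by (rule card_Un_le)
    finally show ?thesis
      using hypercube_like_card_verts[OF join.hyps(1)] less_exp[of n] by linarith
  qed
  then show ?case using card by simp
qed

subsection \<open>Edge cuts of line graphs\<close>

abbreviation incident :: "'a set set \<Rightarrow> 'a \<Rightarrow> 'a set set" where
  "incident X w \<equiv> {e \<in> X. w \<in> e}"

lemma wf_line_graph:
  assumes "wf_graph G"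
  shows "wf_graph (line_graph G)"
proof -
  have "c \<subseteq> edges G \<and> card c = 2" if c: "c \<in> edges (line_graph G)" for c
  proof -
    obtain e e' where "c = {e, e'}" "e \<in> edges G" "e' \<in> edges G" "e \<noteq> e'"
      using c unfolding line_graph_def by fastforce
    then show ?thesis by simp
  qed
  then show ?thesis
    using wf_graph_finite_edges[OF assms] by (simp add: wf_graph_def line_graph_def)
qed

text \<open>Simplicity makes the common end of two adjacent edges unique, so each edge of the line
  graph belongs to one vertex of \<open>G\<close>.\<close>

lemma two_common_ends:
  assumes "wf_graph G" "e \<in> edges G" "e' \<in> edges G" "v \<noteq> w" "{v, w} \<subseteq> e" "{v, w} \<subseteq> e'"
  shows "e = e'"
proof -
  have "card e = 2" "card e' = 2"
    using assms by (auto simp: wf_graph_def)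
  with assms(4-6) show ?thesis
    by (auto simp: card_2_iff)
qed

text \<open>A cut edge corresponds to a unique triple: the common end \<open>w\<close>, the member
  in \<open>X\<close> and the member outside \<open>X\<close>.\<close>

lemma card_edge_cut_line_graph:
  assumes wf: "wf_graph G" and X: "X \<subseteq> edges G"
  shows "card (edge_cut (line_graph G) X) =
    (\<Sum>w\<in>verts G. card (incident X w) * card (incident (edges G - X) w))"
proof -
  define S where "S = (SIGMA w:verts G. incident X w \<times> incident (edges G - X) w)"
  define h :: "'a \<times> 'a set \<times> 'a set \<Rightarrow> 'a set set" where "h = (\<lambda>(w, e, e'). {e, e'})"
  have fin: "finite (edges G)" "finite (verts G)"
    using wf wf_graph_finite_edges by (auto simp: wf_graph_def)
  have "inj_on h S"
  proof (rule inj_onI)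
    fix a b assume "a \<in> S" "b \<in> S" and eq: "h a = h b"
    then obtain w e e' v d d' where ab: "a = (w, e, e')" "b = (v, d, d')"
      and e: "w \<in> e" "w \<in> e'" "e \<in> X" "e' \<in> edges G" "e' \<notin> X"
      and d: "v \<in> d" "v \<in> d'" "d \<in> X" "d' \<in> edges G" "d' \<notin> X"
      by (auto simp: S_def)
    have "{e, e'} = {d, d'}"
      using eq by (simp add: h_def ab)
    \<comment> \<open>Membership in \<open>X\<close> tells the two elements of the unordered pair
      apart.\<close>
    with e d have "e = d" "e' = d'"
      by (auto simp: doubleton_eq_iff)
    moreover have "v = w"
    proof (rule ccontr)
      assume "v \<noteq> w"
      then have "e = e'"
        using two_common_ends[OF wf, of e e' v w] e d X \<open>e = d\<close> \<open>e' = d'\<close> by blast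
      with e show False by simp
    qed
    ultimately show "a = b" by (simp add: ab)
  qed
  moreover have "h ` S = edge_cut (line_graph G) X"
  proof
    show "h ` S \<subseteq> edge_cut (line_graph G) X"
      using X by (auto simp: S_def h_def edge_cut_def line_graph_def)
    show "edge_cut (line_graph G) X \<subseteq> h ` S"
    proof
      fix c assume "c \<in> edge_cut (line_graph G) X"
      then obtain e e' where c: "c = {e, e'}" "e \<in> X" "e' \<in> edges G - X" "e \<inter> e' \<noteq> {}"
        by (auto simp: edge_cut_def line_graph_def)
      then obtain w where "w \<in> e" "w \<in> e'" by blast
      moreover from this have "w \<in> verts G"
        using c wf by (auto simp: wf_graph_def)
      ultimately have "(w, e, e') \<in> S" "h (w, e, e') = c"
        using c by (auto simp: S_def h_def)
      then show "c \<in> h ` S" by blast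
    qed
  qed
  moreover have "card S = (\<Sum>w\<in>verts G. card (incident X w \<times> incident (edges G - X) w))"
    unfolding S_def using fin finite_subset[OF X] by (intro card_SigmaI) auto
  ultimately show ?thesis
    using card_image[of h S] by (simp add: card_cartesian_product)
qed

lemma card_incident_split:
  assumes "wf_graph G" "X \<subseteq> edges G"
  shows "card (incident X w) + card (incident (edges G - X) w) = deg G w"
proof -
  have "finite (edges G)"
    using wf_graph_finite_edges[OF assms(1)] .
  then have "card (incident X w \<union> incident (edges G - X) w) =
      card (incident X w) + card (incident (edges G - X) w)"
    using finite_subset[OF assms(2)] by (intro card_Un_disjoint) auto
  moreover have "incident X w \<union> incident (edges G - X) w = incident (edges G) w"
    using assms(2) by auto
  ultimately show ?thesis by (simp add: deg_def)
qed

text \<open>The cut formula for \<open>{e}\<close>: each of the two ends contributes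
  \<open>1 * (n - 1)\<close>.\<close>

lemma deg_line_graph:
  assumes wf: "wf_graph G" and reg: "\<And>v. v \<in> verts G \<Longrightarrow> deg G v = n" and e: "e \<in> edges G"
  shows "deg (line_graph G) e = 2 * n - 2"
proof -
  have "card (incident {e} w) * card (incident (edges G - {e}) w) = (if w \<in> e then n - 1 else 0)"
    if "w \<in> verts G" for w
  proof (cases "w \<in> e")
    case True
    then have "incident {e} w = {e}" by auto
    then show ?thesis
      using card_incident_split[OF wf, of "{e}" w] True reg[OF that] e by simp
  next
    case False
    then have "incident {e} w = {}" by auto
    then show ?thesis
      using False by simp
  qed
  then have "card (edge_cut (line_graph G) {e}) = (\<Sum>w\<in>verts G. if w \<in> e then n - 1 else 0)"
    using card_edge_cut_line_graph[OF wf, of "{e}"] e by simp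
  also have "\<dots> = (\<Sum>w\<in>e. n - 1)"
  proof -
    have "finite (verts G)" "verts G \<inter> e = e"
      using wf e by (auto simp: wf_graph_def)
    then show ?thesis
      using sum.inter_restrict[of "verts G" "\<lambda>_. n - 1" e] by simp
  qed
  also have "\<dots> = 2 * n - 2"
    using wf e by (simp add: wf_graph_def diff_mult_distrib2)
  finally show ?thesis
    using edge_cut_singleton[OF wf_line_graph[OF wf]] by simp
qed

text \<open>For positive \<open>x\<close> and \<open>y\<close>,
  \<open>x * y \<ge> x + y - 1\<close>, and \<open>x + y\<close> is the degree.\<close>

lemma mixed_vertex_contribution:
  assumes wf: "wf_graph G" and X: "X \<subseteq> edges G"
    and "incident X w \<noteq> {}" "incident (edges G - X) w \<noteq> {}"
  shows "deg G w - 1 \<le> card (incident X w) * card (incident (edges G - X) w)"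
proof -
  have "card (incident X w) \<noteq> 0" "card (incident (edges G - X) w) \<noteq> 0"
    using assms(3,4) wf_graph_finite_edges[OF wf] finite_subset[OF X] by auto
  moreover have "x + y - 1 \<le> x * y" if "x \<noteq> 0" "y \<noteq> 0" for x y :: nat
    using that by (cases x; cases y) auto
  ultimately show ?thesis
    using card_incident_split[OF wf X, of w] by metis
qed

text \<open>The vertices meeting both \<open>X\<close> and its complement each contribute at least \<open>n - 1\<close> to the
  cut. If there are at most three of them and every vertex meets the complement, then \<open>X\<close> consists
  of edges between them, and some vertex meets exactly two edges of \<open>X\<close>.\<close>

lemma line_cut_few_mixed:
  assumes wf: "wf_graph G" and reg: "\<And>v. v \<in> verts G \<Longrightarrow> deg G v = n"
    and X: "X \<subseteq> edges G" "2 \<le> card X"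
    and M_def: "M = {w \<in> verts G. incident X w \<noteq> {} \<and> incident (edges G - X) w \<noteq> {}}"
    and M: "card M \<le> 3" "card M < n"
    and noY: "\<And>w. w \<in> verts G \<Longrightarrow> incident (edges G - X) w \<noteq> {}"
  shows "4 * n - 6 \<le> (\<Sum>w\<in>M. card (incident X w) * card (incident (edges G - X) w))"
proof -
  let ?c = "\<lambda>w. card (incident X w) * card (incident (edges G - X) w)"
  have fin: "finite (verts G)" "finite (edges G)" "finite X" "finite M"
    using wf wf_graph_finite_edges[OF wf] finite_subset[OF X(1)] by (auto simp: wf_graph_def M_def)
  have XM: "e \<subseteq> M" "card e = 2" if "e \<in> X" for e
  proof -
    have "e \<subseteq> verts G" "card e = 2"
      using that X wf by (auto simp: wf_graph_def)
    then show "e \<subseteq> M" "card e = 2"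
      using noY that unfolding M_def by blast+
  qed
  have mixed: "n - 1 \<le> ?c w" if "w \<in> M" for w
    using mixed_vertex_contribution[OF wf X(1), of w] reg[of w] that by (simp add: M_def)
  obtain e e' where e: "e \<in> X" "e' \<in> X" "e \<noteq> e'"
    using X(2) fin(3) card_le_Suc0_iff_eq[of X] by auto
  have finite_e: "finite e" "finite e'"
    using XM e fin finite_subset by blast+
  \<comment> \<open>Two edges inside a set of at most three vertices must meet.\<close>
  have "card (e \<union> e') \<le> card M"
    using XM e fin by (intro card_mono) auto
  moreover have "card (e \<union> e') + card (e \<inter> e') = 4"
    using card_Un_Int[OF finite_e] XM e by simp
  ultimately have "card (e \<inter> e') \<noteq> 0" using M by linarith
  then obtain w where w: "w \<in> e" "w \<in> e'"
    by (metis card.empty disjoint_iff)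
  have "e \<inter> e' = {w}"
  proof (rule ccontr)
    assume "e \<inter> e' \<noteq> {w}"
    with w obtain z where "z \<noteq> w" "z \<in> e" "z \<in> e'" by blast
    then have "e = e'"
      using e w X(1) by (intro two_common_ends[OF wf, of e e' z w]) auto
    with e show False by simp
  qed
  with \<open>card (e \<union> e') + card (e \<inter> e') = 4\<close> \<open>card (e \<union> e') \<le> card M\<close> M
  have M3: "card M = 3" "n \<ge> 4" by auto
  have wM: "w \<in> M" using XM e w by blast
  \<comment> \<open>An edge of \<open>X\<close> at \<open>w\<close> can only lead to one of the
    other two vertices of \<open>M\<close>.\<close>
  have "incident X w \<subseteq> (\<lambda>v. {w, v}) ` (M - {w})"
  proof
    fix d assume "d \<in> incident X w"
    then have "d \<subseteq> M" "card d = 2" "w \<in> d" using XM by auto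
    then show "d \<in> (\<lambda>v. {w, v}) ` (M - {w})"
      by (auto simp: card_2_iff)
  qed
  then have "card (incident X w) \<le> card (M - {w})"
    using fin by (intro surj_card_le) auto
  also have "\<dots> = 2"
    using M3 wM fin by simp
  finally have "card (incident X w) \<le> 2" .
  moreover have "card {e, e'} \<le> card (incident X w)"
    using e w fin by (intro card_mono) auto
  ultimately have "card (incident X w) = 2"
    using e by simp
  then have cw: "?c w = 2 * (n - 2)"
    using card_incident_split[OF wf X(1), of w] reg[of w] wM by (auto simp: M_def)
  \<comment> \<open>With the other two vertices giving \<open>n - 1\<close> each, the total is
    \<open>2 * (n - 2) + 2 * (n - 1) = 4 * n - 6\<close>.\<close>
  have "(\<Sum>v\<in>M - {w}. n - 1) \<le> (\<Sum>v\<in>M - {w}. ?c v)"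
    using mixed by (intro sum_mono) auto
  moreover have "(\<Sum>v\<in>M. ?c v) = ?c w + (\<Sum>v\<in>M - {w}. ?c v)"
    using fin wM by (intro sum.remove)
  ultimately show ?thesis
    using cw M3 wM fin by simp
qed

text \<open>Many mixed vertices suffice by their individual contributions. If there are fewer than
  \<open>n\<close> and at most three, they cannot separate pure vertices of the two kinds, so one
  kind is absent.\<close>

lemma hypercube_like_line_cut:
  assumes n: "n \<ge> 3" and Q: "hypercube_like n Q"
    and X: "X \<subseteq> edges Q" "2 \<le> card X" "2 \<le> card (edges Q - X)"
  shows "4 * n - 6 \<le> card (edge_cut (line_graph Q) X)"
proof -
  let ?Y = "edges Q - X"
  let ?c = "\<lambda>w. card (incident X w) * card (incident ?Y w)"
  note wf = hypercube_like_wf[OF Q] and reg = hypercube_like_deg[OF Q]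
  define M where "M = {w \<in> verts Q. incident X w \<noteq> {} \<and> incident ?Y w \<noteq> {}}"
  have fin: "finite (verts Q)" "finite (edges Q)" "finite X" "finite M"
    using wf wf_graph_finite_edges[OF wf] finite_subset[OF X(1)] by (auto simp: wf_graph_def M_def)
  have mixed: "n - 1 \<le> ?c w" if "w \<in> M" for w
    using mixed_vertex_contribution[OF wf X(1), of w] reg[of w] that by (simp add: M_def)
  have "4 * n - 6 \<le> (\<Sum>w\<in>M. ?c w)"
  proof (cases "card M \<le> 3 \<and> card M < n")
    case False
    have "card M * (n - 1) \<le> (\<Sum>w\<in>M. ?c w)"
      using sum_mono[of M "\<lambda>_. n - 1" ?c] mixed by simp
    moreover have "4 * n - 6 \<le> card M * (n - 1)"
    proof (cases "card M \<ge> 4")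
      case True
      then have "4 * (n - 1) \<le> card M * (n - 1)" by (rule mult_le_mono1)
      then show ?thesis by linarith
    next
      case F: False
      \<comment> \<open>The boundary case is tight: three vertices contribute at least 2 each, and
        \<open>4 * 3 - 6 = 6\<close>.\<close>
      with False n have "n = 3" "card M = 3" by auto
      then show ?thesis by simp
    qed
    ultimately show ?thesis by linarith
  next
    case True
    define A where "A = {w \<in> verts Q. incident X w = {}}"
    define B where "B = {w \<in> verts Q. incident ?Y w = {}}"
    have "A = {} \<or> B = {}"
    proof (rule ccontr)
      assume ne: "\<not> (A = {} \<or> B = {})"
      have "A \<inter> B = {}"
      proof -
        have False if "w \<in> A" "w \<in> B" for w
        proof -
          have "w \<in> verts Q" "incident X w = {}" "incident ?Y w = {}"
            using that unfolding A_def B_def by blast+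
          then show False
            using card_incident_split[OF wf X(1), of w] reg[of w] n by (simp only: card.empty)
        qed
        then show ?thesis by blast
      qed
      \<comment> \<open>Such an edge would lie neither in \<open>X\<close> nor in its
        complement.\<close>
      moreover have "{a, b} \<notin> edges Q" if "a \<in> A" "b \<in> B" for a b
        using that unfolding A_def B_def by blast
      ultimately have "n \<le> card (verts Q - A - B)"
        using ne by (intro hypercube_like_separator[OF Q]) (auto simp: A_def B_def)
      moreover have "verts Q - A - B = M"
        by (auto simp: A_def B_def M_def)
      ultimately show False using True by simp
    qed
    then show ?thesis
    proof
      assume "B = {}"
      then have "incident ?Y w \<noteq> {}" if "w \<in> verts Q" for w
        using that by (simp add: B_def)
      from line_cut_few_mixed[OF wf reg X(1,2) M_def _ _ this] True show ?thesis by blast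
    next
      assume "A = {}"
      \<comment> \<open>The cut is symmetric, so the same bound applies with \<open>X\<close> and
        its complement exchanged.\<close>
      have XX: "edges Q - ?Y = X" using X(1) by auto
      have "incident (edges Q - ?Y) w \<noteq> {}" if "w \<in> verts Q" for w
        using that \<open>A = {}\<close> unfolding XX by (simp add: A_def)
      moreover have "M = {w \<in> verts Q. incident ?Y w \<noteq> {} \<and> incident (edges Q - ?Y) w \<noteq> {}}"
        unfolding XX M_def by blast
      ultimately have "4 * n - 6 \<le>
          (\<Sum>w\<in>M. card (incident ?Y w) * card (incident (edges Q - ?Y) w))"
        using True by (intro line_cut_few_mixed[OF wf reg _ X(3)]) auto
      then show ?thesis unfolding XX by (simp add: mult.commute)
    qed
  qed
  also have "\<dots> \<le> (\<Sum>w\<in>verts Q. ?c w)"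
    using fin by (intro sum_mono2) (auto simp: M_def)
  finally show ?thesis
    using card_edge_cut_line_graph[OF wf X(1)] by simp
qed

subsection \<open>Fault tolerance\<close>

lemma edge_disjoint_paths_imp_upath:
  "edge_disjoint_paths G u v k \<Longrightarrow> 0 < k \<Longrightarrow> \<exists>p. upath G u v p"
  unfolding edge_disjoint_paths_def by (metis card.empty equals0I less_irrefl)

text \<open>Menger's theorem in the faulty graph: cuts around \<open>s\<close> or \<open>t\<close>
  have the size of their degrees, and every other cut keeps at least
  \<open>(4 * n - 6) - (2 * n - 4) = 2 * n - 2\<close> edges, the maximal possible degree.\<close>

lemma hypercube_like_line_faults:
  assumes n: "n \<ge> 3" and Q: "hypercube_like n Q"
    and F: "F \<subseteq> edges (line_graph Q)" "finite F" "card F \<le> 2 * n - 4"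
  shows "strongly_Menger_edge_connected (delete_edges (line_graph Q) F)"
proof -
  let ?L = "line_graph Q"
  let ?G = "delete_edges ?L F"
  note wf = hypercube_like_wf[OF Q] and reg = hypercube_like_deg[OF Q]
  note wfL = wf_line_graph[OF wf]
  have wfG: "wf_graph ?G"
    using wfL by (simp add: wf_graph_def delete_edges_def)
  have V: "verts ?G = edges Q" "verts ?L = edges Q"
    by (simp_all add: delete_edges_def line_graph_def)
  have cut: "edge_cut ?G X = edge_cut ?L X - F" for X
    by (auto simp: edge_cut_def delete_edges_def)
  have lower: "card (edge_cut ?L X) - (2 * n - 4) \<le> card (edge_cut ?G X)" for X
    using diff_card_le_card_Diff[OF F(2), of "edge_cut ?L X"] F(3) unfolding cut by linarith
  have finL: "finite (edge_cut ?L X)" for X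
    using wf_graph_finite_edges[OF wfL] by (simp add: edge_cut_def)
  have degL: "card (edge_cut ?L {e}) = 2 * n - 2" if "e \<in> edges Q" for e
    using edge_cut_singleton[OF wfL] deg_line_graph[OF wf reg that] by simp
  have degG: "2 \<le> deg ?G e" "deg ?G e \<le> 2 * n - 2" if "e \<in> edges Q" for e
  proof -
    show "2 \<le> deg ?G e"
      using lower[of "{e}"] degL[OF that] n edge_cut_singleton[OF wfG, of e] by linarith
    have "card (edge_cut ?G {e}) \<le> card (edge_cut ?L {e})"
      unfolding cut using finL by (intro card_mono) auto
    then show "deg ?G e \<le> 2 * n - 2"
      using degL[OF that] edge_cut_singleton[OF wfG, of e] by linarith
  qed
  have paths: "edge_disjoint_paths ?G s t (min (deg ?G s) (deg ?G t))"
    if st: "s \<in> edges Q" "t \<in> edges Q" "s \<noteq> t" for s t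
  proof (rule edge_Menger[OF wfG])
    show "s \<in> verts ?G" "s \<noteq> t" using st V by auto
    fix X assume X: "X \<subseteq> verts ?G" "s \<in> X" "t \<notin> X"
    have fin: "finite X" "finite (edges Q)"
      using X V wf_graph_finite_edges[OF wf] finite_subset by metis+
    consider "X = {s}" | "edges Q - X = {t}" | "2 \<le> card X" "2 \<le> card (edges Q - X)"
    proof (cases "2 \<le> card X \<and> 2 \<le> card (edges Q - X)")
      case False
      then consider "card X \<le> Suc 0" | "card (edges Q - X) \<le> Suc 0" by linarith
      then show ?thesis
      proof cases
        case 1
        then have "X = {s}"
          using X(2) fin(1) by (auto simp: card_le_Suc0_iff_eq)
        then show ?thesis using that(1) by blast
      next
        case 2
        then have "edges Q - X = {t}"
          using X(3) st(2) fin(2) by (auto simp: card_le_Suc0_iff_eq)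
        then show ?thesis using that(2) by blast
      qed
    qed (use that(3) in blast)
    then show "min (deg ?G s) (deg ?G t) \<le> card (edge_cut ?G X)"
    proof cases
      case 1
      then show ?thesis using edge_cut_singleton[OF wfG] by simp
    next
      case 2
      then have "edge_cut ?G X = edge_cut ?G {t}"
        using edge_cut_complement[OF wfG X(1)] V by simp
      then show ?thesis using edge_cut_singleton[OF wfG] by simp
    next
      case 3
      then have "4 * n - 6 \<le> card (edge_cut ?L X)"
        using X V by (intro hypercube_like_line_cut[OF n Q]) auto
      then show ?thesis
        using lower[of X] degG(2)[OF st(1)] n by linarith
    qed
  qed
  \<comment> \<open>Degrees stay at least \<open>(2 * n - 2) - (2 * n - 4) = 2\<close>, so
    \<open>paths\<close> yields a path between any two distinct vertices.\<close>
  have "connected_graph ?G"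
    unfolding connected_graph_def V
  proof (intro conjI ballI)
    obtain v where "v \<in> verts Q"
      using hypercube_like_card_verts[OF Q] by fastforce
    then have "card {e \<in> edges Q. v \<in> e} = n"
      using reg by (simp add: deg_def)
    then show "edges Q \<noteq> {}"
      using n by auto
    fix u v assume uv: "u \<in> edges Q" "v \<in> edges Q"
    show "\<exists>p. upath ?G u v p"
    proof (cases "u = v")
      case True
      then show ?thesis
        using uv V by (intro exI[of _ "[u]"]) (simp add: upath_def)
    next
      case False
      then show ?thesis
        using edge_disjoint_paths_imp_upath[OF paths[OF uv]] degG(1)[OF uv(1)] degG(1)[OF uv(2)]
        by simp
    qed
  qed
  then show ?thesis
    using paths V by (simp add: strongly_Menger_edge_connected_def)
qed

text \<open>A path cannot leave \<open>u\<close> through a pendant neighbour, so one edge at \<open>u\<close> is useless.\<close>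

lemma pendant_neighbour_paths:
  assumes wf: "wf_graph G" and uw: "{u, w} \<in> edges G" and v: "v \<noteq> u" "v \<noteq> w"
    and pendant: "\<And>e. e \<in> edges G \<Longrightarrow> w \<in> e \<Longrightarrow> e = {u, w}"
    and paths: "edge_disjoint_paths G u v k"
  shows "k < deg G u"
proof -
  obtain P where P: "finite P" "card P = k" "\<And>p. p \<in> P \<Longrightarrow> upath G u v p"
    "\<And>p q. p \<in> P \<Longrightarrow> q \<in> P \<Longrightarrow> p \<noteq> q \<Longrightarrow> path_edges p \<inter> path_edges q = {}"
    using paths unfolding edge_disjoint_paths_def pairwise_def by blast
  \<comment> \<open>The first edge of a path; edge-disjointness makes \<open>h\<close> injective on
    \<open>P\<close>.\<close>
  define h where "h p = {p ! 0, p ! Suc 0}" for p :: "'a list"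
  define S where "S = {e \<in> edges G. u \<in> e} - {{u, w}}"
  have finE: "finite (edges G)" using wf_graph_finite_edges[OF wf] .
  have h: "h p \<in> S" "h p \<in> path_edges p" if "p \<in> P" for p
  proof -
    have p: "p \<noteq> []" "p ! 0 = u" "last p = v" "distinct p"
      "\<And>i. Suc i < length p \<Longrightarrow> {p ! i, p ! Suc i} \<in> edges G"
      using P(3)[OF that] by (auto simp: upath_def hd_conv_nth)
    have last: "p ! (length p - 1) = v"
      using p by (simp add: last_conv_nth)
    have len: "Suc 0 < length p"
    proof (rule ccontr)
      assume "\<not> Suc 0 < length p"
      then have "length p - 1 = 0" by simp
      with last p v show False by simp
    qed
    then show "h p \<in> path_edges p"
      by (auto simp: h_def path_edges_def)
    \<comment> \<open>As \<open>w\<close> is not the target, the path would have to continue from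
      \<open>w\<close>, but only back to \<open>u\<close>.\<close>
    have "p ! Suc 0 \<noteq> w"
    proof
      assume 1: "p ! Suc 0 = w"
      have len2: "Suc (Suc 0) < length p"
      proof (rule ccontr)
        assume "\<not> Suc (Suc 0) < length p"
        with len have "length p - 1 = Suc 0" by simp
        with last 1 v show False by simp
      qed
      then have "{w, p ! Suc (Suc 0)} = {u, w}"
        using p(5)[of "Suc 0"] 1 by (intro pendant) auto
      then have "p ! Suc (Suc 0) = p ! 0 \<or> p ! Suc (Suc 0) = p ! Suc 0"
        using p 1 by (auto simp: doubleton_eq_iff)
      then show False
        using p(1,4) len2 by (auto simp: nth_eq_iff_index_eq)
    qed
    moreover have "p ! Suc 0 \<noteq> u"
      using p len by (metis nth_eq_iff_index_eq length_greater_0_conv nat.distinct(1))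
    ultimately show "h p \<in> S"
      using p(2) p(5)[OF len] by (auto simp: S_def h_def doubleton_eq_iff)
  qed
  have "inj_on h P"
    using h(2) P(4) by (metis disjoint_iff inj_onI)
  then have "k \<le> card S"
    using h(1) P(2) finE card_inj_on_le[of h P S] by (auto simp: S_def)
  moreover have "card S < deg G u"
    unfolding deg_def S_def using uw finE by (intro psubset_card_mono) auto
  ultimately show ?thesis by simp
qed

text \<open>The faults make \<open>w\<close> a pendant neighbour of \<open>u\<close>. A vertex
  \<open>v\<close> not adjacent to \<open>w\<close> keeps degree \<open>2 * n - 2\<close>, so strong
  Menger connectedness would demand \<open>deg u\<close> paths from \<open>u\<close> to
  \<open>v\<close>.\<close>

lemma hypercube_like_line_not_tolerant:
  assumes n: "n \<ge> 3" and Q: "hypercube_like n Q"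
  shows "\<exists>F \<subseteq> edges (line_graph Q). finite F \<and> card F = 2 * n - 3 \<and>
    \<not> strongly_Menger_edge_connected (delete_edges (line_graph Q) F)"
proof -
  let ?L = "line_graph Q"
  note wf = hypercube_like_wf[OF Q] and reg = hypercube_like_deg[OF Q]
  note wfL = wf_line_graph[OF wf]
  have finE: "finite (edges Q)" using wf_graph_finite_edges[OF wf] .
  have finL: "finite (edges ?L)" using wf_graph_finite_edges[OF wfL] .
  have star: "card (incident (edges Q) x) = n" if "x \<in> verts Q" for x
    using reg[OF that] by (simp add: deg_def)
  obtain x where x: "x \<in> verts Q"
    using hypercube_like_card_verts[OF Q] by fastforce
  have "\<not> card (incident (edges Q) x) \<le> Suc 0"
    using star[OF x] n by simp
  then obtain u w where uw: "u \<in> edges Q" "w \<in> edges Q" "u \<noteq> w" "x \<in> u" "x \<in> w"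
    using finE by (auto simp: card_le_Suc0_iff_eq)
  obtain v where v: "v \<in> edges Q" "v \<inter> w = {}"
  proof -
    obtain a b where ab: "w = {a, b}"
      using uw(2) wf by (auto simp: wf_graph_def card_2_iff)
    have "\<not> verts Q \<subseteq> {a, b}"
    proof
      assume "verts Q \<subseteq> {a, b}"
      then have "card (verts Q) \<le> card {a, b}" by (intro card_mono) auto
      also have "\<dots> \<le> 2" by (simp add: card_insert_if)
      also have "\<dots> < n" using n by simp
      also have "n < 2 ^ n" by (rule less_exp)
      finally show False using hypercube_like_card_verts[OF Q] by simp
    qed
    then obtain y where y: "y \<in> verts Q" "y \<noteq> a" "y \<noteq> b" by blast
    \<comment> \<open>At most two of the \<open>n \<ge> 3\<close> edges at \<open>y\<close> lead to
      \<open>w\<close>; any other one can serve as \<open>v\<close>.\<close>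
    have "\<not> incident (edges Q) y \<subseteq> {{a, y}, {b, y}}"
    proof
      assume "incident (edges Q) y \<subseteq> {{a, y}, {b, y}}"
      then have "card (incident (edges Q) y) \<le> card {{a, y}, {b, y}}" by (intro card_mono) auto
      also have "\<dots> \<le> 2" by (simp add: card_insert_if)
      finally show False using star[OF y(1)] n by simp
    qed
    then obtain e where e: "e \<in> edges Q" "y \<in> e" "e \<noteq> {a, y}" "e \<noteq> {b, y}" by blast
    moreover have "card e = 2" using e wf by (auto simp: wf_graph_def)
    ultimately have "e \<inter> w = {}"
      using y unfolding ab by (auto simp: card_2_iff)
    with e that show ?thesis by blast
  qed
  define F where "F = incident (edges ?L) w - {{u, w}}"
  let ?G = "delete_edges ?L F"
  have uwL: "{u, w} \<in> edges ?L"
    using uw by (auto simp: line_graph_def)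
  have vw: "v \<noteq> w" "v \<noteq> u"
    using v uw by auto
  have "card F = 2 * n - 3"
    using deg_line_graph[OF wf reg uw(2)] uwL finL by (simp add: F_def deg_def)
  moreover have "\<not> strongly_Menger_edge_connected ?G"
  proof
    assume "strongly_Menger_edge_connected ?G"
    then have "edge_disjoint_paths ?G u v (min (deg ?G u) (deg ?G v))"
      using uw v vw by (auto simp: strongly_Menger_edge_connected_def delete_edges_def line_graph_def)
    moreover have "wf_graph ?G"
      using wfL by (simp add: wf_graph_def delete_edges_def)
    moreover have "{u, w} \<in> edges ?G"
      using uwL by (simp add: delete_edges_def F_def)
    moreover have "e = {u, w}" if "e \<in> edges ?G" "w \<in> e" for e
      using that by (auto simp: delete_edges_def F_def)
    ultimately have "min (deg ?G u) (deg ?G v) < deg ?G u"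
      using pendant_neighbour_paths vw by metis
    moreover have "deg ?G v = deg ?L v"
    proof -
      have "v \<notin> e" if "e \<in> F" for e
        using that v vw by (auto simp: F_def line_graph_def)
      then have "incident (edges ?G) v = incident (edges ?L) v"
        by (auto simp: delete_edges_def)
      then show ?thesis by (simp add: deg_def)
    qed
    moreover have "deg ?G u \<le> deg ?L u"
      unfolding deg_def using finL by (intro card_mono) (auto simp: delete_edges_def)
    ultimately show False
      using deg_line_graph[OF wf reg uw(1)] deg_line_graph[OF wf reg v(1)] by simp
  qed
  ultimately show ?thesis
    using finL by (intro exI[of _ F]) (auto simp: F_def)
qed

theorem theorem3p3:
  fixes n :: nat and Q :: "'a ugraph"
  assumes "n \<ge> 3" and "hypercube_like n Q"
  shows "edge_fault_tolerant_strongly_Menger (2 * n - 4) (line_graph Q) \<and>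
         (\<forall>k. k > 2 * n - 4 \<longrightarrow> \<not> edge_fault_tolerant_strongly_Menger k (line_graph Q))"
proof (intro conjI allI impI)
  \<comment> \<open>Connectedness of the line graph itself is the case of no faults.\<close>
  have "delete_edges (line_graph Q) {} = line_graph Q"
    by (simp add: delete_edges_def)
  then have "connected_graph (line_graph Q)"
    using hypercube_like_line_faults[OF assms, of "{}"]
    by (simp add: strongly_Menger_edge_connected_def)
  then show "edge_fault_tolerant_strongly_Menger (2 * n - 4) (line_graph Q)"
    using hypercube_like_line_faults[OF assms] by (simp add: edge_fault_tolerant_strongly_Menger_def)
  fix k assume "k > 2 * n - 4"
  \<comment> \<open>One fault set of size \<open>2 * n - 3\<close> refutes every larger
    \<open>k\<close>, as tolerance quantifies over all sets of size at most
    \<open>k\<close>.\<close>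
  with assms(1) have k: "2 * n - 3 \<le> k" by simp
  obtain F where "F \<subseteq> edges (line_graph Q)" "finite F" "card F = 2 * n - 3"
    "\<not> strongly_Menger_edge_connected (delete_edges (line_graph Q) F)"
    using hypercube_like_line_not_tolerant[OF assms] by blast
  with k show "\<not> edge_fault_tolerant_strongly_Menger k (line_graph Q)"
    unfolding edge_fault_tolerant_strongly_Menger_def by auto
qed

end
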